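(* Let $T$ be any rooted ordered labeled tree with $n_T$ nodes, let $D$ be its (minimal) DAG and $\mathcal{TD}$ its top DAG. Then $n_{\mathcal{TD}} = O(\log n_T)\cdot n_D$ for every such $T$, and there exist (infinite) families of trees $T$ for which $n_D = \Omega(n_T/\log n_T)\cdot n_{\mathcal{TD}}$.
   Context: A labeled tree $T$ is a rooted, ordered tree each of whose nodes carries a label; $n_T$ is its number of nodes and $p(v)$ denotes the parent of $v$. For a graph $G$, $n_G$ is its total size (vertices plus edges). The DAG $D$ of $T$ is the minimal DAG representation of $T$ obtained by representing identical rooted subtrees of $T$ (same structure and labels) only once. Clusters. For a node $v$ with children $v_1,\dots,v_k$ (left to right), $T(v)$ is the subtree consisting of $v$ and its descendants, $F(v)$ the forest of proper descendants of $v$, and for $1\le s\le r\le k$, $T(v,v_s,v_r)$ is the tree pattern induced by $\{v\}\cup T(v_s)\cup\dots\cup T(v_r)$. A cluster with top boundary node $v$ is either a pattern $T(v,v_s,v_r)$ (no bottom boundary node) or a pattern $T(v,v_s,v_r)\setminus F(u)$ for a node $u$ of $T(v_s)\cup\dots\cup T(v_r)$ ($u$ is its bottom boundary node). A single edge $(v,p(v))$ is a cluster with top boundary $p(v)$, and with bottom boundary $v$ unless $v$ is a leaf of $T$. Two edge-disjoint clusters $A,B$ sharing one boundary node can be merged into $C=A\cup B$ (when $C$ is a cluster) in five ways: vertical merges, where the bottom boundary node of $A$ is the top boundary node of $B$ and $B$ contains all children of this node (allowed only if this node is a boundary node of no cluster other than $A,B$): type (a) if $B$ has a bottom boundary node,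 type (b) if not; horizontal merges, where $A,B$ have the same top boundary node, $A$ left of $B$, and at least one of them has no bottom boundary node: type (c) if only $A$ has a bottom boundary node, (d) if only $B$ has one, (e) if neither has one. $A$ is always the cluster first visited in a preorder traversal of $T$. Top tree. A top tree of $T$ is an ordered rooted binary labeled tree whose nodes correspond to clusters: the root to $T$, the leaves to the edges of $T$ (labeled by the pair (label of parent endpoint, label of child endpoint)), and each internal node to the merge of its left child's cluster $A$ and right child's cluster $B$, labeled by the merge type (a)–(e). Greedy construction. Maintain an auxiliary rooted ordered tree $\tilde T$, initially $T$, whose edges correspond to the current roots of the partial top tree (initially the edges of $T$). Merging edges $(u,v),(v,w)$ of $\tilde T$ creates a new top tree node whose children are the two corresponding clusters; if $v$ is the parent of $u$ and the only child of $w$ (vertical merge) the two edges are replaced by $(u,w)$; if $v$ is the parent of both $u,w$ and one of $u,w$ is a leaf (horizontal merge) they are replaced by a single edge from $v$ to one of $u,w$ (the non-leaf one, if any). While $\tilde T$ has more than one edge, do an iteration: Step 1 (horizontal): for each node $v$ of $\tilde T$ with children $v_1,\dots,v_k$, $k\ge 2$, for $i=1,\dots,\lfloor k/2\rfloor$ merge $(v,v_{2i-1}),(v,v_{2i})$ if $v_{2i-1}$ or $v_{2i}$ is a leaf; if $k$ is odd, $v_k$ is a leaf and $v_{k-2},v_{k-1}$ are non-leaves, also merge $(v,v_{k-1}),(v,v_k)$. Step 2 (vertical): for each maximal path $v_1,\dots,v_p$ with $v_{i+1}$ the parent of $v_i$ and $v_2,\dots,v_{p-1}$ each having exactly one child,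 with $e_i=(v_i,v_{i+1})$: if $p$ is even merge $\{e_1,e_2\},\{e_3,e_4\},\dots,\{e_{p-3},e_{p-2}\}$; if $p$ is odd merge $\{e_1,e_2\},\dots,\{e_{p-4},e_{p-3}\}$ and also $\{e_{p-2},e_{p-1}\}$ if $e_{p-1}$ was not merged in Step 1. Top DAG. The top DAG $\mathcal{TD}$ of $T$ is the minimal DAG representation of this top tree $\mathcal T$, in which identical rooted subtrees of $\mathcal T$ are represented once. *)

theory Defs
  imports Complex_Main "HOL-Library.While_Combinator" "Graph_Theory.Digraph"
begin

section \<open>Rooted ordered labeled trees and their minimal DAGs\<close>

datatype 'l tree = Node (label: 'l) (children: "'l tree list")

fun num_nodes :: "'l tree \<Rightarrow> nat" where
  "num_nodes (Node a ts) = 1 + sum_list (map num_nodes ts)"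

fun subtrees :: "'l tree \<Rightarrow> 'l tree set" where
  "subtrees (Node a ts) = insert (Node a ts) (\<Union>t \<in> set ts. subtrees t)"

text \<open>
  The vertices are the rooted subtrees as values, so that identical subtrees (same structure and
  labels) are one vertex; a vertex carries the label of its root. The arc \<open>(t, i)\<close> leads
  from \<open>t\<close> to its \<open>i\<close>-th child. The order of the children is thereby part of the
  DAG, and identical children of one node give parallel arcs.
\<close>

definition minimal_dag :: "'l tree \<Rightarrow> ('l tree, 'l tree \<times> nat) pre_digraph" where
  "minimal_dag T =
    \<lparr> verts = subtrees T,
      arcs = {(t, i). t \<in> subtrees T \<and> i < length (children t)},
      tail = fst,
      head = (\<lambda>(t, i). children t ! i) \<rparr>"

definition graph_size :: "('a, 'b) pre_digraph \<Rightarrow> nat" where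
  "graph_size G = card (verts G) + card (arcs G)"

lemma finite_subtrees: "finite (subtrees T)"
  by (induction T rule: subtrees.induct) auto

lemma subtrees_refl: "T \<in> subtrees T"
  by (cases T) auto

lemma subtrees_child: "t \<in> subtrees T \<Longrightarrow> s \<in> set (children t) \<Longrightarrow> s \<in> subtrees T"
proof (induction T rule: subtrees.induct)
  case (1 a ts)
  show ?case
  proof (cases "t = Node a ts")
    case True
    then show ?thesis using 1(3) subtrees_refl by auto
  next
    case False
    then show ?thesis using 1 by auto
  qed
qed

lemma fin_digraph_minimal_dag: "fin_digraph (minimal_dag T)"
proof
  have "arcs (minimal_dag T) = (SIGMA t : subtrees T. {..<length (children t)})"
    by (auto simp: minimal_dag_def)
  then show "finite (arcs (minimal_dag T))"
    by (simp add: finite_subtrees)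
qed (auto simp: minimal_dag_def finite_subtrees intro: subtrees_child)


section \<open>Top trees\<close>

datatype merge_type = Merge_a | Merge_b | Merge_c | Merge_d | Merge_e

text \<open>
  A top tree is itself a rooted ordered labeled tree. A leaf is labeled by the pair (label of
  the parent endpoint, label of the child endpoint) of an edge, an inner node by a merge type.
\<close>

datatype 'l top_label = Edge_Label "'l \<times> 'l" | Merge_Label merge_type

type_synonym 'l top_tree = "'l top_label tree"

text \<open>
  A current root of the partial top tree: the top tree built for a cluster, together with the
  information whether this cluster has a bottom boundary node. Every cluster has a top boundary
  node. The merge functions take the cluster visited first in preorder (the upper one or the left
  one, respectively) as their first argument.
\<close>

datatype 'l cluster = Cluster (cluster_top_tree: "'l top_tree") (has_bottom: bool)

fun merge_vertical :: "'l cluster \<Rightarrow> 'l cluster \<Rightarrow> 'l cluster" where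
  "merge_vertical (Cluster s p) (Cluster t q) =
    Cluster (Node (Merge_Label (if q then Merge_a else Merge_b)) [s, t]) q"

text \<open>
  A horizontal merge requires that at least one of the clusters has no bottom boundary node, so
  the last alternative is the one where neither has one.
\<close>

fun merge_horizontal :: "'l cluster \<Rightarrow> 'l cluster \<Rightarrow> 'l cluster" where
  "merge_horizontal (Cluster s p) (Cluster t q) =
    Cluster (Node (Merge_Label (if p then Merge_c else if q then Merge_d else Merge_e)) [s, t])
      (p \<or> q)"


section \<open>The greedy construction\<close>

text \<open>
  An edge of the auxiliary tree is given by its cluster, a flag telling whether it results from a
  horizontal merge of the current iteration, and the list of the edges from its lower endpoint
  to the children of that endpoint, left to right. The auxiliary tree is represented by the list
  of the edges at its root.
\<close>

datatype 'l edge = Edge (edge_cluster: "'l cluster") (merged: bool) (below: "'l edge list")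

fun num_edges :: "'l edge list \<Rightarrow> nat" where
  "num_edges [] = 0"
| "num_edges (Edge c m ds # es) = 1 + num_edges ds + num_edges es"

fun initial_edges :: "'l tree \<Rightarrow> 'l edge list" where
  "initial_edges (Node a ts) =
    map (\<lambda>t. Edge (Cluster (Node (Edge_Label (a, label t)) []) (children t \<noteq> [])) False
      (initial_edges t)) ts"

subsection \<open>Horizontal merges\<close>

definition to_leaf :: "'l edge \<Rightarrow> bool" where
  "to_leaf e \<longleftrightarrow> below e = []"

text \<open>One of the two lists below is empty, hence the append keeps the non-leaf, if any.\<close>

definition merge_siblings :: "'l edge \<Rightarrow> 'l edge \<Rightarrow> 'l edge" where
  "merge_siblings d e =
    Edge (merge_horizontal (edge_cluster d) (edge_cluster e)) True (below d @ below e)"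

text \<open>
  The recursion reaches a list of exactly three edges only if the number of children is odd; they
  are then the edges to the last three children.
\<close>

fun horizontal_pairs :: "'l edge list \<Rightarrow> 'l edge list" where
  "horizontal_pairs (d # e # es) =
    (if to_leaf d \<or> to_leaf e then merge_siblings d e # horizontal_pairs es
     else case es of
       [f] \<Rightarrow> if to_leaf f then [d, merge_siblings e f] else [d, e, f]
     | _ \<Rightarrow> d # e # horizontal_pairs es)"
| "horizontal_pairs es = es"

fun horizontal_below :: "'l edge \<Rightarrow> 'l edge" where
  "horizontal_below (Edge c m es) = Edge c m (horizontal_pairs (map horizontal_below es))"

definition horizontal_step :: "'l edge list \<Rightarrow> 'l edge list" where
  "horizontal_step es = horizontal_pairs (map horizontal_below es)"

subsection \<open>Vertical merges\<close>

text \<open>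
  The top node of a maximal path is the root or a node with at least two children. For the topmost
  edge \<open>e\<close> of such a path, \<open>path_edges e\<close> lists the edges of the path from
  bottom to top (each with its flag), and \<open>path_end e\<close> are the edges from the bottom node
  of the path to its children.
\<close>

fun path_edges :: "'l edge \<Rightarrow> ('l cluster \<times> bool) list" where
  "path_edges (Edge c m [e]) = path_edges e @ [(c, m)]"
| "path_edges (Edge c m es) = [(c, m)]"

fun path_end :: "'l edge \<Rightarrow> 'l edge list" where
  "path_end (Edge c m [e]) = path_end e"
| "path_end (Edge c m es) = es"

text \<open>
  The topmost two edges of a path form a pair only if the number of edges is even, i.e. the number
  of nodes is odd. The merge of this pair is the one that depends on the flag.
\<close>

fun vertical_pairs :: "('l cluster \<times> bool) list \<Rightarrow> 'l cluster list" where
  "vertical_pairs ((c, m) # (d, n) # es) =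
    (if es = [] \<and> n then [c, d] else merge_vertical d c # vertical_pairs es)"
| "vertical_pairs es = map fst es"

text \<open>The clusters are listed from bottom to top; the flags are reset for the next iteration.\<close>

fun attach_path :: "'l cluster list \<Rightarrow> 'l edge list \<Rightarrow> 'l edge list" where
  "attach_path [] es = es"
| "attach_path (c # cs) es = attach_path cs [Edge c False es]"

lemma size_path_end: "size_list size (path_end e) < size e"
  by (induction e rule: path_end.induct) auto

function vertical_step :: "'l edge list \<Rightarrow> 'l edge list" where
  "vertical_step [] = []"
| "vertical_step (e # es) =
    attach_path (vertical_pairs (path_edges e)) (vertical_step (path_end e)) @ vertical_step es"
  by pat_completeness auto
termination
  by (relation "measure (size_list size)") (auto simp: less_Suc_eq_le size_path_end trans_le_add1 less_imp_le)

subsection \<open>The top tree and the top DAG\<close>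

text \<open>
  The vertical merges of an iteration are performed on the tree that results from its horizontal
  merges. A tree with a single node has no edge and hence no top tree, so \<open>top_tree T\<close> and
  \<open>top_dag T\<close> are meaningful only for trees with at least two nodes.
\<close>

definition top_tree :: "'l tree \<Rightarrow> 'l top_tree" where
  "top_tree T =
    cluster_top_tree (edge_cluster (hd
      (while (\<lambda>es. num_edges es > 1) (\<lambda>es. vertical_step (horizontal_step es)) (initial_edges T))))"

definition top_dag ::
    "'l tree \<Rightarrow> ('l top_tree, 'l top_tree \<times> nat) pre_digraph" where
  "top_dag T = minimal_dag (top_tree T)"

end

theory Submission
  imports Defs
begin

text \<open>
  Upper bound: the horizontal merges below a node depend only on the list of edges to its children,
  and paths are paired from the bottom, so as long as a non-root node survives, the edges below it
  evolve in the same way for all occurrences of a subtree. Hence every iteration produces only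
  \<open>O(n\<^sub>D)\<close> different clusters. Every iteration also removes at least a sixth of the edges,
  which gives \<open>O(log n\<^sub>T)\<close> iterations. Lower bound: on a unary path with
  \<open>2\<^sup>k\<close> edges every iteration has just two different clusters, whereas all subtrees
  of the path are different.
\<close>

text \<open>The list below a surviving node could feel the surroundings only through the topmost
  pair of a path, whose merge depends on a flag set by a horizontal merge with a sibling. That flag
  decides merely whether the node between the two edges survives; if it does, the list below it is
  the one that flag-free pairing from the bottom yields. So away from the root one function
  \<open>inner_step\<close> describes an iteration, and after \<open>i\<close> iterations every list
  below a non-root node is \<open>(inner_step ^^ i) (initial_edges t)\<close> for some subtree
  \<open>t\<close> of \<open>T\<close>. Lists never grow, so the lists for all vertices of
  \<open>D\<close> together have at most as many entries as \<open>D\<close> has arcs. The list at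
  the root follows \<open>step\<close> instead and is counted apart. The sixth balances two
  estimates. If the horizontal step performs \<open>m\<close> merges and leaves \<open>h\<close>
  edges, a credit argument bounds four times the final number of edges by
  \<open>3 * h + 5 * m\<close>. This is weak for large \<open>m\<close>, but then \<open>h\<close>
  itself, also an upper bound, is small.\<close>

lemma edge_forest_induct:
  assumes "\<And>es. (\<And>e. e \<in> set es \<Longrightarrow> P (below e)) \<Longrightarrow> P es"
  shows "P es"
proof (induction es rule: measure_induct_rule[of "size_list size"])
  case (less es)
  have "size_list size (below e) < size_list size es" if "e \<in> set es" for e
  proof -
    have "size_list size (below e) < size e" by (cases e) simp
    also have "\<dots> \<le> size_list size es"
      using that by (induction es) auto
    finally show ?thesis .
  qed
  then show ?case using less assms by blast
qed

text \<open>Edges are collected as values, so occurrences of one subtree that have evolved alike are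
  counted once, as in \<open>D\<close>.\<close>

fun all_edges :: "'l edge list \<Rightarrow> 'l edge set" where
  "all_edges [] = {}"
| "all_edges (Edge c m ds # es) = insert (Edge c m ds) (all_edges ds \<union> all_edges es)"

lemma all_edges_Cons: "all_edges (e # es) = insert e (all_edges (below e) \<union> all_edges es)"
  by (cases e) auto

lemma all_edges_unfold: "all_edges es = set es \<union> (\<Union>e\<in>set es. all_edges (below e))"
  by (induction es) (auto simp: all_edges_Cons)

lemma all_edges_append [simp]: "all_edges (ds @ es) = all_edges ds \<union> all_edges es"
  by (auto simp: all_edges_unfold[of "_ @ _"] all_edges_unfold[of ds] all_edges_unfold[of es])

lemma all_edges_below: "e \<in> all_edges es \<Longrightarrow> all_edges (below e) \<subseteq> all_edges es"
  by (induction es rule: all_edges.induct) auto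

text \<open>Reduces counting edges to counting lists of child edges, the objects that evolve
  deterministically. Only the list at the root lies below no edge.\<close>

lemma all_edges_eq_below:
  "all_edges es = set es \<union> (\<Union>l \<in> below ` all_edges es. set l)"
proof
  show "all_edges es \<subseteq> set es \<union> (\<Union>l \<in> below ` all_edges es. set l)"
    by (induction es rule: all_edges.induct) auto
  have "set l \<subseteq> all_edges l" for l :: "'l edge list"
    using all_edges_unfold[of l] by blast
  then show "set es \<union> (\<Union>l \<in> below ` all_edges es. set l) \<subseteq> all_edges es"
    using all_edges_below by blast
qed

lemma in_below_all_edges:
  "l \<in> below ` all_edges es \<longleftrightarrow>
    (\<exists>e\<in>set es. l = below e \<or> l \<in> below ` all_edges (below e))"
  unfolding all_edges_unfold[of es] by blast

abbreviation edge_tree :: "'l edge \<Rightarrow> 'l top_tree" where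
  "edge_tree e \<equiv> cluster_top_tree (edge_cluster e)"

definition top_trees :: "'l edge list \<Rightarrow> 'l top_tree set" where
  "top_trees es = edge_tree ` all_edges es"

lemma in_top_trees:
  "x \<in> top_trees es \<longleftrightarrow> (\<exists>e\<in>set es. x = edge_tree e \<or> x \<in> top_trees (below e))"
  unfolding top_trees_def all_edges_unfold[of es] by blast

text \<open>What one round of merges can make of the roots \<open>A\<close>: each tree is kept or
  becomes a child of a new root. The arity bound is what later makes the top DAG binary.\<close>

definition with_parents :: "'l top_tree set \<Rightarrow> 'l top_tree set" where
  "with_parents A = A \<union> {x. length (children x) \<le> 2 \<and> set (children x) \<subseteq> A}"

lemma with_parents_mono: "A \<subseteq> B \<Longrightarrow> with_parents A \<subseteq> with_parents B"
  by (auto simp: with_parents_def)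

lemma subtrees_with_parents:
  assumes "x \<in> with_parents A"
  shows "subtrees x \<subseteq> insert x (\<Union>(subtrees ` A))"
proof (cases "x \<in> A")
  case False
  then show ?thesis using assms by (cases x) (auto simp: with_parents_def)
qed auto

lemma children_merge:
  "children (cluster_top_tree (merge_vertical c d)) = [cluster_top_tree c, cluster_top_tree d]"
  "children (cluster_top_tree (merge_horizontal c d)) = [cluster_top_tree c, cluster_top_tree d]"
  by (cases c; cases d; simp)+


section \<open>Clusters of the horizontal step\<close>

lemma horizontal_below_simps [simp]:
  "edge_cluster (horizontal_below e) = edge_cluster e"
  "merged (horizontal_below e) = merged e"
  "below (horizontal_below e) = horizontal_step (below e)"
  by (cases e; simp add: horizontal_step_def)+

lemma horizontal_step_Nil [simp]: "horizontal_step [] = []"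
  by (simp add: horizontal_step_def)

lemma merge_siblings_simps [simp]:
  "edge_cluster (merge_siblings d e) = merge_horizontal (edge_cluster d) (edge_cluster e)"
  "merged (merge_siblings d e)"
  "below (merge_siblings d e) = below d @ below e"
  by (simp_all add: merge_siblings_def)

text \<open>Speaks of argument and result together, so that proofs by this rule need not reopen the
  nested case distinction on the last three edges; \<open>skip\<close> carries the negation of the
  condition of \<open>last_three\<close>.\<close>

lemma horizontal_pairs_induct
    [case_names Nil single pair last_three skip]:
  assumes "Q [] []" "\<And>e. Q [e] [e]"
    and "\<And>d e es. to_leaf d \<or> to_leaf e \<Longrightarrow> Q es (horizontal_pairs es) \<Longrightarrow>
      Q (d # e # es) (merge_siblings d e # horizontal_pairs es)"
    and "\<And>d e f. \<not> to_leaf d \<Longrightarrow> \<not> to_leaf e \<Longrightarrow> to_leaf f \<Longrightarrow>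
      Q [d, e, f] [d, merge_siblings e f]"
    and "\<And>d e es. \<not> to_leaf d \<Longrightarrow> \<not> to_leaf e \<Longrightarrow> (\<And>f. es = [f] \<Longrightarrow> \<not> to_leaf f) \<Longrightarrow>
      Q es (horizontal_pairs es) \<Longrightarrow> Q (d # e # es) (d # e # horizontal_pairs es)"
  shows "Q es (horizontal_pairs es)"
proof (induction es rule: induct_list012)
  case (3 d e es)
  show ?case
  proof (cases "to_leaf d \<or> to_leaf e")
    case True
    then show ?thesis using assms(3) 3(1) by simp
  next
    case False
    then show ?thesis
    proof (cases "\<exists>f. es = [f] \<and> to_leaf f")
      case True
      then show ?thesis using False assms(4) by auto
    next
      case last: False
      have "horizontal_pairs (d # e # es) = d # e # horizontal_pairs es"
        using False last by (cases es rule: horizontal_pairs.cases) auto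
      then show ?thesis using False last assms(5) 3(1) by auto
    qed
  qed
qed (use assms in auto)

lemma length_horizontal_pairs: "length (horizontal_pairs es) \<le> length es"
  by (induction es rule: horizontal_pairs_induct) auto

lemma length_horizontal_step: "length (horizontal_step es) \<le> length es"
  using length_horizontal_pairs[of "map horizontal_below es"] by (simp add: horizontal_step_def)

text \<open>At least one of two merged siblings is a leaf, so the concatenated list is just the old
  list of the other one.\<close>

lemma below_horizontal_pairs: "below ` set (horizontal_pairs es) \<subseteq> below ` set es"
  by (induction es rule: horizontal_pairs_induct) (auto simp: to_leaf_def)

lemma edge_tree_horizontal_pairs:
  "edge_tree ` set (horizontal_pairs es) \<subseteq> with_parents (edge_tree ` set es)"
  by (induction es rule: horizontal_pairs_induct)
     (auto simp: with_parents_def children_merge)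

lemma below_horizontal_step:
  "below ` all_edges (horizontal_step es) \<subseteq> horizontal_step ` below ` all_edges es"
proof (induction es rule: edge_forest_induct)
  case (1 es)
  have s: "below ` set (horizontal_step es) \<subseteq> horizontal_step ` below ` set es"
    using below_horizontal_pairs[of "map horizontal_below es"]
    by (auto simp: horizontal_step_def image_image)
  show ?case
  proof
    fix l assume "l \<in> below ` all_edges (horizontal_step es)"
    then obtain e where e: "e \<in> set (horizontal_step es)"
      "l = below e \<or> l \<in> below ` all_edges (below e)"
      unfolding in_below_all_edges[of _ "horizontal_step es"] by blast
    then obtain d where d: "d \<in> set es" "below e = horizontal_step (below d)"
      using s by blast
    then obtain l' where "l' = below d \<or> l' \<in> below ` all_edges (below d)" "l = horizontal_step l'"
      using e(2) 1[OF d(1)] by auto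
    then show "l \<in> horizontal_step ` below ` all_edges es"
      using d(1) in_below_all_edges[of l' es] by blast
  qed
qed

lemma top_trees_horizontal_step:
  "top_trees (horizontal_step es) \<subseteq> with_parents (top_trees es)"
proof (induction es rule: edge_forest_induct)
  case (1 es)
  have s: "below ` set (horizontal_step es) \<subseteq> horizontal_step ` below ` set es"
    using below_horizontal_pairs[of "map horizontal_below es"]
    by (auto simp: horizontal_step_def image_image)
  show ?case
  proof
    fix x assume "x \<in> top_trees (horizontal_step es)"
    then consider "x \<in> edge_tree ` set (horizontal_step es)"
      | e where "e \<in> set (horizontal_step es)" "x \<in> top_trees (below e)"
      unfolding in_top_trees[of _ "horizontal_step es"] by blast
    then show "x \<in> with_parents (top_trees es)"
    proof cases
      case 1
      have "edge_tree ` set (horizontal_step es) \<subseteq> with_parents (edge_tree ` set es)"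
        using edge_tree_horizontal_pairs[of "map horizontal_below es"]
        by (simp add: horizontal_step_def image_image)
      moreover have "edge_tree ` set es \<subseteq> top_trees es"
        using in_top_trees[of _ es] by blast
      ultimately show ?thesis using 1 with_parents_mono by blast
    next
      case 2
      then obtain d where d: "d \<in> set es" "below e = horizontal_step (below d)"
        using s by auto
      moreover have "top_trees (below d) \<subseteq> top_trees es"
        using d in_top_trees[of _ es] by blast
      ultimately show ?thesis using 1 2 with_parents_mono by (metis subsetD)
    qed
  qed
qed


section \<open>Clusters of the vertical step\<close>

lemma path_edges_not_Nil [simp]: "path_edges e \<noteq> []"
  by (cases e rule: path_edges.cases) auto

lemma vertical_pairs_eq_Nil_iff [simp]: "vertical_pairs ps = [] \<longleftrightarrow> ps = []"
  by (cases ps rule: vertical_pairs.cases) auto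

lemma attach_path_append: "attach_path (cs @ ds) es = attach_path ds (attach_path cs es)"
  by (induction cs arbitrary: es) auto

lemma length_attach_path: "length (attach_path cs es) = (if cs = [] then length es else 1)"
  by (induction cs arbitrary: es) auto

lemma length_vertical_step [simp]: "length (vertical_step es) = length es"
  by (induction es rule: vertical_step.induct) (auto simp: length_attach_path)

lemma edge_tree_vertical_pairs:
  "cluster_top_tree ` set (vertical_pairs ps) \<subseteq> with_parents (cluster_top_tree ` fst ` set ps)"
  by (induction ps rule: vertical_pairs.induct) (auto simp: with_parents_def children_merge)

lemma edge_cluster_path_edges: "fst ` set (path_edges e) \<subseteq> edge_cluster ` all_edges [e]"
  by (induction e rule: path_edges.induct) auto

lemma all_edges_path_end: "all_edges (path_end e) \<subseteq> all_edges [e]"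
  by (induction e rule: path_end.induct) auto

lemma top_trees_attach_path:
  "top_trees (attach_path cs es) = cluster_top_tree ` set cs \<union> top_trees es"
  by (induction cs arbitrary: es) (auto simp: top_trees_def)

lemma top_trees_vertical_step: "top_trees (vertical_step es) \<subseteq> with_parents (top_trees es)"
proof (induction es rule: vertical_step.induct)
  case 1
  then show ?case by (simp add: top_trees_def)
next
  case (2 e es)
  have *: "top_trees (vertical_step (e # es)) =
      cluster_top_tree ` set (vertical_pairs (path_edges e)) \<union>
      top_trees (vertical_step (path_end e)) \<union> top_trees (vertical_step es)"
    using top_trees_attach_path[of "vertical_pairs (path_edges e)" "vertical_step (path_end e)"]
    by (simp add: top_trees_def image_Un)
  have e: "all_edges [e] \<subseteq> all_edges (e # es)" by (auto simp: all_edges_Cons)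
  have "cluster_top_tree ` fst ` set (path_edges e) \<subseteq> top_trees (e # es)"
    using edge_cluster_path_edges[of e] e unfolding top_trees_def by fastforce
  moreover have "top_trees (path_end e) \<subseteq> top_trees (e # es)"
    using all_edges_path_end[of e] e unfolding top_trees_def by blast
  moreover have "top_trees es \<subseteq> top_trees (e # es)"
    by (auto simp: top_trees_def all_edges_Cons)
  ultimately show ?case
    using 2[THEN subset_trans, OF with_parents_mono]
      edge_tree_vertical_pairs[THEN subset_trans, OF with_parents_mono]
    unfolding * by (intro Un_least)
qed

text \<open>The pairing on the lower part of a path that continues upward: the topmost edge of the
  part is not the topmost edge of the path, so its flag must not be consulted.\<close>

fun inner_pairs :: "('l cluster \<times> bool) list \<Rightarrow> 'l cluster list" where
  "inner_pairs ((c, m) # (d, n) # es) = merge_vertical d c # inner_pairs es"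
| "inner_pairs es = map fst es"

text \<open>
  The vertical step on the edges below a non-root node that survives it. A node with exactly one
  child is the top node of a path only if it is the root, so the flag-dependent last pair plays no
  role here.
\<close>

fun inner_vertical_step :: "'l edge list \<Rightarrow> 'l edge list" where
  "inner_vertical_step [e] =
    attach_path (inner_pairs (path_edges e)) (vertical_step (path_end e))"
| "inner_vertical_step es = vertical_step es"

lemma inner_vertical_step_eq: "length es \<noteq> 1 \<Longrightarrow> inner_vertical_step es = vertical_step es"
  by (cases es rule: inner_vertical_step.cases) auto

lemma inner_pairs_eq_Nil_iff [simp]: "inner_pairs ps = [] \<longleftrightarrow> ps = []"
  by (cases ps rule: inner_pairs.cases) auto

lemma length_inner_vertical_step [simp]: "length (inner_vertical_step es) = length es"
  by (cases es rule: inner_vertical_step.cases) (auto simp: length_attach_path)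

lemma length_path_end: "length (path_end e) \<noteq> 1"
  by (induction e rule: path_end.induct) auto

lemma path_end_below: "path_end e \<in> below ` all_edges [e]"
  by (induction e rule: path_end.induct) auto

text \<open>Cutting a path at an inner node leaves the path of the edge below that node. An inner
  node has a single child, hence the singleton list.\<close>

lemma path_prefix:
  assumes "0 < m" "m < length (path_edges e)"
  obtains d where "[d] \<in> below ` all_edges [e]" "path_edges d = take m (path_edges e)"
    "path_end d = path_end e"
  using assms
proof (induction e arbitrary: thesis rule: path_edges.induct)
  case (1 c k e)
  show ?case
  proof (cases "m = length (path_edges e)")
    case True
    then show ?thesis using 1(2)[of e] by auto
  next
    case False
    then have m: "m < length (path_edges e)" using 1(4) by simp
    obtain d where d: "[d] \<in> below ` all_edges [e]"
      "path_edges d = take m (path_edges e)" "path_end d = path_end e"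
      using 1(1)[OF _ 1(3) m] .
    then show ?thesis using m by (intro 1(2)[of d]) auto
  qed
qed auto

text \<open>The flag matters only for a topmost pair. If that pair merges, a proper prefix of the
  result excludes it; if the flag blocks it, the prefix may end with the lower edge, which
  \<open>inner_pairs\<close> leaves alone as the odd one out.\<close>

lemma take_vertical_pairs:
  assumes "0 < k" "k < length (vertical_pairs ps)"
  shows "\<exists>m. 0 < m \<and> m < length ps \<and> take k (vertical_pairs ps) = inner_pairs (take m ps)"
  using assms
proof (induction ps arbitrary: k rule: vertical_pairs.induct)
  case (1 c m d n es)
  show ?case
  proof (cases "es = [] \<and> n")
    case True
    then have "k = 1" using 1(2,3) by simp
    then show ?thesis using True by (intro exI[of _ 1]) simp
  next
    case False
    show ?thesis
    proof (cases "k = 1")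
      case True
      then show ?thesis using False 1(3) by (intro exI[of _ 2]) auto
    next
      case k: False
      then obtain j where j: "k = Suc j" "0 < j" using 1(2) by (cases k) auto
      then obtain i where "0 < i" "i < length es"
        "take j (vertical_pairs es) = inner_pairs (take i es)"
        using 1(1)[OF False, of j] 1(3) False by auto
      then show ?thesis using False j by (intro exI[of _ "Suc (Suc i)"]) auto
    qed
  qed
qed auto

lemma below_attach_path:
  "below ` all_edges (attach_path cs es) =
    below ` all_edges es \<union> (\<lambda>k. attach_path (take k cs) es) ` {..<length cs}"
  by (induction cs arbitrary: es) (auto simp: lessThan_Suc_eq_insert_0 image_image)

text \<open>Below the nodes kept on a path lie the attached proper prefixes of its clusters. The
  empty prefix belongs to the bottom node of the path, whose list is never a singleton; the others
  are \<open>inner_vertical_step [d]\<close> with \<open>d\<close> from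
  \<open>path_prefix\<close>.\<close>

lemma below_vertical_step:
  "below ` all_edges (vertical_step es) \<subseteq> inner_vertical_step ` below ` all_edges es"
proof (induction es rule: vertical_step.induct)
  case 1
  then show ?case by simp
next
  case (2 e es)
  let ?cs = "vertical_pairs (path_edges e)" and ?E = "vertical_step (path_end e)"
  have "attach_path (take k ?cs) ?E \<in> inner_vertical_step ` below ` all_edges [e]"
    if k: "k < length ?cs" for k
  proof (cases "k = 0")
    case True
    then show ?thesis
      using inner_vertical_step_eq[OF length_path_end] path_end_below
      by (metis attach_path.simps(1) image_eqI take0)
  next
    case False
    then obtain m where m: "0 < m" "m < length (path_edges e)"
      "take k ?cs = inner_pairs (take m (path_edges e))"
      using take_vertical_pairs k by blast
    obtain d where d: "[d] \<in> below ` all_edges [e]"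
      "path_edges d = take m (path_edges e)" "path_end d = path_end e"
      using path_prefix[OF m(1,2)] by blast
    have "attach_path (take k ?cs) ?E = inner_vertical_step [d]"
      using m d by simp
    then show ?thesis using d(1) by (metis image_eqI)
  qed
  then have "below ` all_edges (attach_path ?cs ?E)
      \<subseteq> inner_vertical_step ` below ` (all_edges (path_end e) \<union> all_edges [e])"
    unfolding below_attach_path using 2(1) unfolding image_Un by blast
  also have "\<dots> \<subseteq> inner_vertical_step ` below ` all_edges (e # es)"
    using all_edges_path_end[of e] by (intro image_mono) (auto simp: all_edges_Cons)
  finally have "below ` all_edges (attach_path ?cs ?E)
      \<subseteq> inner_vertical_step ` below ` all_edges (e # es)" .
  moreover have "inner_vertical_step ` below ` all_edges es
      \<subseteq> inner_vertical_step ` below ` all_edges (e # es)"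
    by (intro image_mono) (auto simp: all_edges_Cons)
  ultimately show ?case
    using subset_trans[OF 2(2)] by (simp add: image_Un)
qed


section \<open>Clusters of all iterations\<close>

definition step :: "'l edge list \<Rightarrow> 'l edge list" where
  "step es = vertical_step (horizontal_step es)"

definition inner_step :: "'l edge list \<Rightarrow> 'l edge list" where
  "inner_step es = inner_vertical_step (horizontal_step es)"

lemma length_step: "length (step es) \<le> length es"
  by (simp add: step_def length_horizontal_step)

lemma length_inner_step: "length (inner_step es) \<le> length es"
  by (simp add: inner_step_def length_horizontal_step)

lemma length_funpow_le:
  fixes f :: "'b list \<Rightarrow> 'b list"
  assumes "\<And>xs. length (f xs) \<le> length xs"
  shows "length ((f ^^ i) xs) \<le> length xs"
proof (induction i)
  case (Suc i)
  then show ?case using assms[of "(f ^^ i) xs"] by simp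
qed simp

lemma below_step: "below ` all_edges (step es) \<subseteq> inner_step ` below ` all_edges es"
proof -
  have "below ` all_edges (step es)
      \<subseteq> inner_vertical_step ` below ` all_edges (horizontal_step es)"
    unfolding step_def by (rule below_vertical_step)
  also have "\<dots> \<subseteq> inner_vertical_step ` horizontal_step ` below ` all_edges es"
    by (intro image_mono below_horizontal_step)
  finally show ?thesis by (simp add: inner_step_def image_image)
qed

lemma below_funpow_step:
  "below ` all_edges ((step ^^ i) es) \<subseteq> (inner_step ^^ i) ` below ` all_edges es"
proof (induction i)
  case (Suc i)
  then have "inner_step ` below ` all_edges ((step ^^ i) es)
      \<subseteq> inner_step ` (inner_step ^^ i) ` below ` all_edges es"
    by (rule image_mono)
  then show ?case
    using below_step[of "(step ^^ i) es"] by (simp add: image_comp)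
qed simp

lemma below_initial_edges: "below ` all_edges (initial_edges T) \<subseteq> initial_edges ` subtrees T"
proof (induction T)
  case (Node a ts)
  show ?case
  proof
    fix l assume "l \<in> below ` all_edges (initial_edges (Node a ts))"
    then obtain t where t: "t \<in> set ts"
      "l = initial_edges t \<or> l \<in> below ` all_edges (initial_edges t)"
      unfolding in_below_all_edges[of _ "initial_edges (Node a ts)"] by auto
    then have "l \<in> initial_edges ` subtrees t"
      using Node subtrees_refl by blast
    then show "l \<in> initial_edges ` subtrees (Node a ts)"
      using t(1) by auto
  qed
qed

lemma length_initial_edges [simp]: "length (initial_edges T) = length (children T)"
  by (cases T) simp

lemma finite_all_edges [simp]: "finite (all_edges es)"
  by (induction es rule: all_edges.induct) auto

text \<open>To be used with \<open>S\<close> the vertices of \<open>D\<close> and \<open>F t\<close>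
  the evolved child list of \<open>t\<close>. Lists that coincide for different \<open>t\<close> may
  be counted repeatedly, since the total length is already small enough.\<close>

lemma card_top_trees_le:
  assumes "finite S" "below ` all_edges es \<subseteq> F ` S"
  shows "card (top_trees es) \<le> length es + (\<Sum>t\<in>S. length (F t))"
proof -
  have "all_edges es \<subseteq> set es \<union> (\<Union>t\<in>S. set (F t))"
  proof (subst all_edges_eq_below, intro Un_mono order_refl UN_least)
    fix l assume "l \<in> below ` all_edges es"
    from subsetD[OF assms(2) this] show "set l \<subseteq> (\<Union>t\<in>S. set (F t))" by auto
  qed
  then have "card (top_trees es) \<le> card (set es \<union> (\<Union>t\<in>S. set (F t)))"
    unfolding top_trees_def using assms(1)
    by (intro order_trans[OF card_image_le[OF finite_all_edges]] card_mono) auto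
  also have "\<dots> \<le> card (set es) + (\<Sum>t\<in>S. card (set (F t)))"
    using card_UN_le[OF assms(1), of "\<lambda>t. set (F t)"] card_Un_le[of "set es"]
    by (meson add_left_mono order_trans)
  also have "\<dots> \<le> length es + (\<Sum>t\<in>S. length (F t))"
    by (intro add_mono sum_mono card_length)
  finally show ?thesis .
qed

lemma card_arcs_minimal_dag:
  "card (arcs (minimal_dag T)) = (\<Sum>t\<in>subtrees T. length (children t))"
proof -
  have "arcs (minimal_dag T) = (SIGMA t : subtrees T. {..<length (children t)})"
    by (auto simp: minimal_dag_def)
  then show ?thesis by (simp add: finite_subtrees)
qed

text \<open>One copy of the number of arcs pays for the list at the root, the other for all lists
  below. The intermediate forest is bounded too, because a vertical merge may join clusters created
  by the horizontal step of the same iteration.\<close>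

lemma card_top_trees_iterate:
  fixes T :: "'l tree"
  defines "N \<equiv> 2 * card (arcs (minimal_dag T))"
  shows "card (top_trees ((step ^^ i) (initial_edges T))) \<le> N"
    and "card (top_trees (horizontal_step ((step ^^ i) (initial_edges T)))) \<le> N"
proof -
  let ?A = "\<Sum>t\<in>subtrees T. length (children t)"
  let ?B = "(step ^^ i) (initial_edges T)"
  let ?F = "\<lambda>t. (inner_step ^^ i) (initial_edges t)"
  have N: "N = ?A + ?A" by (simp add: N_def card_arcs_minimal_dag)
  have F: "length (?F t) \<le> length (children t)" for t :: "'l tree"
    using length_funpow_le[of inner_step i "initial_edges t", OF length_inner_step] by simp
  have "length (children T) \<le> ?A"
    using subtrees_refl finite_subtrees by (intro member_le_sum) auto
  then have B: "length ?B \<le> ?A"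
    using length_funpow_le[of step i "initial_edges T", OF length_step] by simp
  have *: "below ` all_edges ?B \<subseteq> ?F ` subtrees T"
    using subset_trans[OF below_funpow_step image_mono[OF below_initial_edges]]
    by (simp only: image_image)
  have "(\<Sum>t\<in>subtrees T. length (?F t)) \<le> ?A"
    by (intro sum_mono F)
  then show "card (top_trees ?B) \<le> N"
    using card_top_trees_le[OF finite_subtrees *] B N by simp
  have **: "below ` all_edges (horizontal_step ?B) \<subseteq> (\<lambda>t. horizontal_step (?F t)) ` subtrees T"
    using subset_trans[OF below_horizontal_step image_mono[OF *]]
    by (simp only: image_image)
  have "(\<Sum>t\<in>subtrees T. length (horizontal_step (?F t))) \<le> ?A"
    by (intro sum_mono order_trans[OF length_horizontal_step F])
  then show "card (top_trees (horizontal_step ?B)) \<le> N"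
    using card_top_trees_le[OF finite_subtrees **] B N length_horizontal_step[of ?B] by simp
qed

section \<open>Vertices of the top DAG accumulated over the iterations\<close>

lemma top_trees_initial_edges: "x \<in> top_trees (initial_edges T) \<Longrightarrow> children x = []"
proof (induction T)
  case (Node a ts)
  then obtain e where "e \<in> set (initial_edges (Node a ts))"
    "x = edge_tree e \<or> x \<in> top_trees (below e)"
    unfolding in_top_trees[of _ "initial_edges (Node a ts)"] by blast
  then show ?case using Node.IH by auto
qed

definition all_top_subtrees :: "'l edge list \<Rightarrow> 'l top_tree set" where
  "all_top_subtrees es = (\<Union>x\<in>top_trees es. subtrees x)"

lemma top_trees_subset: "top_trees es \<subseteq> all_top_subtrees es"
  using subtrees_refl by (fastforce simp: all_top_subtrees_def)

lemma finite_top_trees [simp]: "finite (top_trees es)"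
  by (simp add: top_trees_def)

lemma finite_all_top_subtrees [simp]: "finite (all_top_subtrees es)"
  by (simp add: all_top_subtrees_def finite_subtrees)

text \<open>A merge puts one vertex on top of old roots, so a half-step adds at most its own current
  roots to the subtrees seen so far.\<close>

lemma all_top_subtrees_with_parents:
  assumes "top_trees ds \<subseteq> with_parents (top_trees es)"
  shows "all_top_subtrees ds \<subseteq> top_trees ds \<union> all_top_subtrees es"
proof
  fix y assume "y \<in> all_top_subtrees ds"
  then obtain x where x: "x \<in> top_trees ds" "y \<in> subtrees x"
    by (auto simp: all_top_subtrees_def)
  then show "y \<in> top_trees ds \<union> all_top_subtrees es"
    using subtrees_with_parents[of x "top_trees es"] assms by (auto simp: all_top_subtrees_def)
qed

lemma all_top_subtrees_step:
  "all_top_subtrees (step es)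
    \<subseteq> top_trees (step es) \<union> top_trees (horizontal_step es) \<union> all_top_subtrees es"
  using all_top_subtrees_with_parents[OF top_trees_vertical_step[of "horizontal_step es"]]
    all_top_subtrees_with_parents[OF top_trees_horizontal_step[of es]]
  by (auto simp: step_def)

lemma binary_with_parents:
  assumes "top_trees ds \<subseteq> with_parents (top_trees es)"
    and "\<And>x. x \<in> all_top_subtrees es \<Longrightarrow> length (children x) \<le> 2"
    and "x \<in> all_top_subtrees ds"
  shows "length (children x) \<le> 2"
proof -
  from all_top_subtrees_with_parents[OF assms(1)] assms(3)
  consider "x \<in> all_top_subtrees es" | "x \<in> with_parents (top_trees es)"
    using assms(1) by blast
  then show ?thesis
    using assms(2) top_trees_subset by cases (auto simp: with_parents_def)
qed

lemma subtrees_no_children: "children x = [] \<Longrightarrow> subtrees x = {x}"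
  by (cases x) simp

lemma all_top_subtrees_initial: "all_top_subtrees (initial_edges T) = top_trees (initial_edges T)"
  using subtrees_no_children[OF top_trees_initial_edges] by (auto simp: all_top_subtrees_def)

lemma binary_iterate:
  "x \<in> all_top_subtrees ((step ^^ i) (initial_edges T)) \<Longrightarrow> length (children x) \<le> 2"
proof (induction i arbitrary: x)
  case 0
  then show ?case using top_trees_initial_edges[of x T] by (simp add: all_top_subtrees_initial)
next
  case (Suc i)
  let ?es = "(step ^^ i) (initial_edges T)"
  have "length (children y) \<le> 2" if "y \<in> all_top_subtrees (horizontal_step ?es)" for y
    using binary_with_parents[OF top_trees_horizontal_step Suc.IH that] .
  then show ?case
    using binary_with_parents[OF top_trees_vertical_step[of "horizontal_step ?es"]] Suc.prems
    by (simp flip: step_def)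
qed

text \<open>There are \<open>2 * i + 1\<close> families of current roots: the initial one and two
  for each iteration.\<close>

lemma card_all_top_subtrees_iterate:
  "card (all_top_subtrees ((step ^^ i) (initial_edges T)))
    \<le> (2 * i + 1) * (2 * card (arcs (minimal_dag T)))"
proof (induction i)
  case 0
  then show ?case using card_top_trees_iterate(1)[of 0 T] by (simp add: all_top_subtrees_initial)
next
  case (Suc i)
  let ?es = "(step ^^ i) (initial_edges T)"
  have "card (all_top_subtrees (step ?es))
      \<le> card (top_trees (step ?es) \<union> top_trees (horizontal_step ?es) \<union> all_top_subtrees ?es)"
    by (intro card_mono all_top_subtrees_step) simp
  also have "\<dots> \<le> card (top_trees (step ?es)) + card (top_trees (horizontal_step ?es))
      + card (all_top_subtrees ?es)"
    by (meson add_right_mono card_Un_le order_trans)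
  also have "\<dots> \<le> (2 * Suc i + 1) * (2 * card (arcs (minimal_dag T)))"
    using card_top_trees_iterate(1)[of "Suc i" T] card_top_trees_iterate(2)[of i T] Suc by simp
  finally show ?case by simp
qed

lemma graph_size_binary:
  assumes "\<And>s. s \<in> subtrees t \<Longrightarrow> length (children s) \<le> 2"
  shows "graph_size (minimal_dag t) \<le> 3 * card (subtrees t)"
proof -
  have "card (arcs (minimal_dag t)) \<le> 2 * card (subtrees t)"
    unfolding card_arcs_minimal_dag
    using sum_bounded_above[of "subtrees t" "\<lambda>s. length (children s)" 2] assms
    by (simp add: mult.commute)
  then show ?thesis by (simp add: graph_size_def minimal_dag_def)
qed


section \<open>The number of iterations\<close>

text \<open>As \<open>vertical_step\<close> clears all flags, this counts the horizontal merges of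
  the current iteration, each of which removes one edge.\<close>

fun num_merged :: "'l edge list \<Rightarrow> nat" where
  "num_merged [] = 0"
| "num_merged (Edge c m ds # es) = of_bool m + num_merged ds + num_merged es"

lemma num_edges_Cons: "num_edges (e # es) = 1 + num_edges (below e) + num_edges es"
  by (cases e) auto

lemma num_merged_Cons: "num_merged (e # es) = of_bool (merged e) + num_merged (below e) + num_merged es"
  by (cases e) auto

lemma num_edges_append [simp]: "num_edges (ds @ es) = num_edges ds + num_edges es"
  by (induction ds) (auto simp: num_edges_Cons)

lemma num_merged_append [simp]: "num_merged (ds @ es) = num_merged ds + num_merged es"
  by (induction ds) (auto simp: num_merged_Cons)

lemma num_edges_horizontal_pairs:
  assumes "\<forall>e\<in>set es. \<not> merged e"
  shows "num_edges (horizontal_pairs es) + num_merged (horizontal_pairs es)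
    = num_edges es + num_merged es"
  using assms
  by (induction es rule: horizontal_pairs_induct) (auto simp: num_edges_Cons num_merged_Cons)

lemma num_merged_eq_0_iff:
  "num_merged es = 0 \<longleftrightarrow> (\<forall>e\<in>set es. \<not> merged e \<and> num_merged (below e) = 0)"
  by (induction es) (auto simp: num_merged_Cons)

lemma num_edges_horizontal_step:
  "num_merged es = 0 \<Longrightarrow>
    num_edges (horizontal_step es) + num_merged (horizontal_step es) = num_edges es"
proof (induction es rule: edge_forest_induct)
  case (1 es)
  have m: "\<forall>e\<in>set es. \<not> merged e \<and> num_merged (below e) = 0"
    using 1(2) num_merged_eq_0_iff by blast
  then have "\<forall>e\<in>set es. \<not> merged e \<and>
      num_edges (horizontal_step (below e)) + num_merged (horizontal_step (below e))
        = num_edges (below e)"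
    using 1(1) by blast
  then have *: "num_edges (map horizontal_below es) + num_merged (map horizontal_below es)
      = num_edges es"
    by (induction es) (auto simp: num_edges_Cons num_merged_Cons)
  have "num_edges (horizontal_step es) + num_merged (horizontal_step es)
      = num_edges (map horizontal_below es) + num_merged (map horizontal_below es)"
    unfolding horizontal_step_def using m by (intro num_edges_horizontal_pairs) auto
  then show ?case using * by simp
qed

section \<open>Path-wise counting of edges and flags in the vertical step\<close>

lemma num_edges_attach_path [simp]: "num_edges (attach_path cs es) = length cs + num_edges es"
  by (induction cs arbitrary: es) auto

lemma num_merged_attach_path [simp]: "num_merged (attach_path cs es) = num_merged es"
  by (induction cs arbitrary: es) auto

lemma num_merged_vertical_step [simp]: "num_merged (vertical_step es) = 0"
  by (induction es rule: vertical_step.induct) auto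

lemma num_edges_path:
  "num_edges (e # es) = length (path_edges e) + num_edges (path_end e) + num_edges es"
  by (induction e arbitrary: es rule: path_edges.induct) auto

text \<open>Only the topmost flag of a path can block a merge; flags on its other edges are dropped,
  hence an inequality.\<close>

lemma num_merged_path:
  "num_merged (e # es) \<ge> of_bool (merged e) + num_merged (path_end e) + num_merged es"
proof -
  have "num_merged [e] \<ge> of_bool (merged e) + num_merged (path_end e)"
    by (induction e rule: path_end.induct) auto
  then show ?thesis using num_merged_append[of "[e]" es] by simp
qed

lemma length_vertical_pairs_le: "length (vertical_pairs ps) \<le> length ps"
  by (induction ps rule: vertical_pairs.induct) auto

lemma num_edges_vertical_step_le: "num_edges (vertical_step es) \<le> num_edges es"
  by (induction es rule: vertical_step.induct)
     (auto simp: num_edges_path intro: add_mono length_vertical_pairs_le)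

lemma last_path_edges: "last (path_edges e) = (edge_cluster e, merged e)"
  by (cases e rule: path_edges.cases) auto

text \<open>A blocked topmost pair costs one merge, and only if the number of edges is even; for odd
  numbers both bounds agree.\<close>

lemma length_vertical_pairs:
  "ps \<noteq> [] \<Longrightarrow> length (vertical_pairs ps) \<le>
    (if snd (last ps) then length ps div 2 + 1 else (length ps + 1) div 2)"
  by (induction ps rule: vertical_pairs.induct) (auto split: if_splits)

lemma length_path_edges_leaf: "length (path_edges e) = 1 \<Longrightarrow> path_end e = below e"
  by (cases e rule: path_edges.cases) auto

text \<open>The horizontal merges pay for the leaves that the iteration leaves alone.\<close>

definition leaves_paid :: "'l edge list \<Rightarrow> bool" where
  "leaves_paid es \<longleftrightarrow> length es = 1 \<or>
    length (filter (\<lambda>e. to_leaf e \<and> \<not> merged e) es) \<le> length (filter merged es)"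

text \<open>A leaf is left alone only as the last of an odd number of children. If there are at
  least three, the pair before it must have been merged, since otherwise the rule for the last three
  edges would apply.\<close>

lemma leaves_paid_horizontal_pairs: "leaves_paid (horizontal_pairs es)"
proof -
  have "(length es = 1 \<longrightarrow> horizontal_pairs es = es) \<and>
    (length es \<noteq> 1 \<longrightarrow> length (filter (\<lambda>e. to_leaf e \<and> \<not> merged e) (horizontal_pairs es))
      \<le> length (filter merged (horizontal_pairs es)))"
    by (induction es rule: horizontal_pairs_induct) (auto simp: length_Suc_conv split: if_splits)
  then show ?thesis by (cases "length es = 1") (auto simp: leaves_paid_def)
qed

lemma leaves_paid_horizontal_step: "leaves_paid (horizontal_step es)"
  by (simp add: horizontal_step_def leaves_paid_horizontal_pairs)

lemma leaves_paid_below_horizontal_step: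
  assumes "l \<in> below ` all_edges (horizontal_step es)"
  shows "leaves_paid l"
  using subsetD[OF below_horizontal_step assms] leaves_paid_horizontal_step by auto

text \<open>The value is 1, plus 2 for a merged edge, minus 2 for an unmerged leaf. So in a list
  with at least as many merged edges as unmerged leaves the credits sum to at least its length,
  although single leaves are in debt.\<close>

definition credit :: "'l edge \<Rightarrow> int" where
  "credit e = (if merged e then 3 else if to_leaf e then - 1 else 1)"

lemma sum_credit_ge:
  "int (length es) + 2 * int (length (filter merged es))
    - 2 * int (length (filter (\<lambda>e. to_leaf e \<and> \<not> merged e) es)) \<le> (\<Sum>e\<leftarrow>es. credit e)"
  by (induction es) (auto simp: credit_def)

lemma sum_credit_leaves_paid:
  assumes "leaves_paid es" "length es \<noteq> 1"
  shows "int (length es) \<le> (\<Sum>e\<leftarrow>es. credit e)"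
  using assms sum_credit_ge[of es] by (auto simp: leaves_paid_def)

text \<open>Proved path by path, moving the credit at the lower end to the topmost edge. A nonempty
  lower end has at least two edges, hence credit at least 2; this pays for a path of one edge above
  a branching node, where nothing is saved. The 5 per merge pays for a blocked pair.\<close>

lemma num_edges_vertical_step:
  assumes "\<And>l. l \<in> below ` all_edges es \<Longrightarrow> leaves_paid l"
  shows "4 * int (num_edges (vertical_step es)) + (\<Sum>e\<leftarrow>es. credit e)
    \<le> 3 * int (num_edges es) + 5 * int (num_merged es)"
  using assms
proof (induction es rule: vertical_step.induct)
  case 1
  then show ?case by simp
next
  case (2 e es)
  let ?ps = "path_edges e" and ?E = "path_end e"
  have sub: "all_edges ?E \<subseteq> all_edges (e # es)" "all_edges es \<subseteq> all_edges (e # es)"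
    using all_edges_path_end[of e] by (auto simp: all_edges_Cons)
  have IH: "4 * int (num_edges (vertical_step ?E)) + (\<Sum>e\<leftarrow>?E. credit e)
      \<le> 3 * int (num_edges ?E) + 5 * int (num_merged ?E)"
    "4 * int (num_edges (vertical_step es)) + (\<Sum>e\<leftarrow>es. credit e)
      \<le> 3 * int (num_edges es) + 5 * int (num_merged es)"
    using 2 sub by blast+
  have "?E \<in> below ` all_edges (e # es)"
    using path_end_below[of e] by (auto simp: all_edges_Cons)
  then have "int (length ?E) \<le> (\<Sum>e\<leftarrow>?E. credit e)"
    using sum_credit_leaves_paid 2(3) length_path_end by blast
  then have E: "(if ?E = [] then 0 else 2) \<le> (\<Sum>e\<leftarrow>?E. credit e)"
    using length_path_end[of e] by (cases ?E) (auto simp: neq_Nil_conv)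
  have len: "length ?ps > 0" by simp
  have v: "length (vertical_pairs ?ps) \<le>
      (if merged e then length ?ps div 2 + 1 else (length ?ps + 1) div 2)"
    using length_vertical_pairs[of ?ps] by (simp add: last_path_edges)
  have "4 * int (length (vertical_pairs ?ps)) + credit e
      \<le> 3 * int (length ?ps) + 5 * of_bool (merged e) + (if ?E = [] then 0 else 2)"
  proof (cases "length ?ps = 1")
    case True
    then show ?thesis
      using v length_path_edges_leaf[OF True] by (auto simp: credit_def to_leaf_def)
  next
    case False
    then have "length ?ps \<ge> 2" using len by linarith
    \<comment> \<open>Tight for two edges with a blocked pair and for three edges without a flag on
      top.\<close>
    then have "4 * length (vertical_pairs ?ps) + (if merged e then 3 else 1)
        \<le> 3 * length ?ps + (if merged e then 5 else 0)"
      using v by (cases "merged e"; simp; presburger)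
    then show ?thesis by (auto simp: credit_def split: if_splits)
  qed
  moreover have "of_bool (merged e) + int (num_merged ?E) + int (num_merged es)
      \<le> int (num_merged (e # es))"
    using num_merged_path[of e es] by (cases "merged e") simp_all
  ultimately show ?case
    using IH E num_edges_path[of e es] by simp
qed

lemma num_edges_step:
  assumes "num_merged es = 0" "num_edges es \<ge> 2"
  shows "6 * num_edges (step es) \<le> 5 * num_edges es"
proof -
  let ?hs = "horizontal_step es"
  have h: "num_edges ?hs + num_merged ?hs = num_edges es"
    using num_edges_horizontal_step assms(1) by blast
  have v: "4 * int (num_edges (step es)) + (\<Sum>e\<leftarrow>?hs. credit e)
      \<le> 3 * int (num_edges ?hs) + 5 * int (num_merged ?hs)"
    unfolding step_def
    by (intro num_edges_vertical_step leaves_paid_below_horizontal_step)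
  have "(\<Sum>e\<leftarrow>?hs. credit e) \<ge> 0"
  proof (cases "length ?hs = 1")
    case False
    then show ?thesis
      using sum_credit_leaves_paid[OF leaves_paid_horizontal_step, of es] by linarith
  next
    case True
    then obtain e where e: "?hs = [e]" by (auto simp: length_Suc_conv)
    \<comment> \<open>A single root edge with negative credit would be an unmerged leaf, and then
      \<open>es\<close> had only one edge.\<close>
    have "merged e \<or> \<not> to_leaf e"
      using h assms e by (auto simp: num_edges_Cons num_merged_Cons to_leaf_def)
    then show ?thesis using e by (auto simp: credit_def)
  qed
  moreover have "num_edges (step es) \<le> num_edges ?hs"
    unfolding step_def by (rule num_edges_vertical_step_le)
  \<comment> \<open>With \<open>n\<close> edges before and \<open>v\<close> after the iteration:
    \<open>4 * v <= 3 * h + 5 * m = 3 * n + 2 * m\<close> and \<open>m = n - h <= n - v\<close> give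
    \<open>6 * v <= 5 * n\<close>.\<close>
  ultimately show ?thesis using h v by linarith
qed

section \<open>Logarithmic number of iterations\<close>

lemma horizontal_pairs_eq_Nil_iff [simp]: "horizontal_pairs es = [] \<longleftrightarrow> es = []"
  by (induction es rule: horizontal_pairs_induct) auto

lemma step_eq_Nil_iff: "step es = [] \<longleftrightarrow> es = []"
proof -
  have "vertical_step es = [] \<longleftrightarrow> es = []" for es :: "'a edge list"
    by (metis length_0_conv length_vertical_step)
  then show ?thesis by (simp add: step_def horizontal_step_def)
qed

lemma num_merged_initial_edges: "num_merged (initial_edges T) = 0"
proof (induction T)
  case (Node a ts)
  then show ?case by (auto simp: num_merged_eq_0_iff[of "map _ _"])
qed

lemma num_merged_iterate: "num_merged ((step ^^ i) (initial_edges T)) = 0"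
  by (cases i) (auto simp: num_merged_initial_edges step_def)

lemma num_edges_initial_edges: "num_edges (initial_edges T) + 1 = num_nodes T"
proof (induction T)
  case (Node a ts)
  then show ?case by (induction ts) (auto simp: num_edges_Cons)
qed

lemma num_edges_iterate:
  assumes "\<forall>i<k. num_edges ((step ^^ i) (initial_edges T)) \<ge> 2"
  shows "6 ^ k * num_edges ((step ^^ k) (initial_edges T)) \<le> 5 ^ k * num_edges (initial_edges T)"
  using assms
proof (induction k)
  case (Suc k)
  let ?es = "(step ^^ k) (initial_edges T)"
  have "6 ^ k * (6 * num_edges (step ?es)) \<le> 6 ^ k * (5 * num_edges ?es)"
    using Suc.prems by (intro mult_left_mono num_edges_step num_merged_iterate) auto
  also have "\<dots> \<le> 5 * (5 ^ k * num_edges (initial_edges T))"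
    using Suc by simp
  finally show ?case by (simp add: algebra_simps)
qed simp

lemma top_tree_iterate:
  obtains k where "top_tree T = edge_tree (hd ((step ^^ k) (initial_edges T)))"
    and "real k \<le> 1 + 4 * log 2 (real (num_nodes T))"
    and "\<And>i. i < k \<Longrightarrow> num_edges ((step ^^ i) (initial_edges T)) > 1"
proof -
  let ?n = "\<lambda>i. num_edges ((step ^^ i) (initial_edges T))"
  \<comment> \<open>Termination is not yet known: both the existence of a stopping index and its
    size come from this estimate.\<close>
  have small: "real i \<le> 4 * log 2 (real (num_nodes T))" if "\<forall>j<Suc i. ?n j \<ge> 2" for i
  proof -
    have "6 ^ i * 1 \<le> 6 ^ i * ?n i" using that by (intro mult_left_mono) fastforce+
    also have "\<dots> \<le> 5 ^ i * num_edges (initial_edges T)"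
      using that by (intro num_edges_iterate) auto
    also have "\<dots> \<le> 5 ^ i * num_nodes T"
      using num_edges_initial_edges[of T] by simp
    finally have "real (6 ^ i) \<le> real (5 ^ i * num_nodes T)"
      by (simp only: of_nat_le_iff)
    then have "(6 / 5) ^ i \<le> real (num_nodes T)"
      by (simp add: power_divide field_simps)
    then have "log 2 ((6 / 5) ^ i) \<le> log 2 (real (num_nodes T))"
      using num_edges_initial_edges[of T] by (subst log_le_cancel_iff) auto
    moreover have "log 2 ((6 / 5) ^ i) = real i * log 2 (6 / 5)"
      by (simp add: log_nat_power)
    moreover have "log 2 ((6 / 5) ^ 4) = 4 * log 2 (6 / 5 :: real)"
      by (subst log_nat_power) auto
    \<comment> \<open>\<open>(6 / 5) ^ 4\<close> is just above 2, which is the origin of the factor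
      4.\<close>
    moreover have "1 \<le> log 2 ((6 / 5) ^ 4 :: real)"
      by (subst le_log_iff) (auto simp: power_divide)
    ultimately have "1 \<le> 4 * log 2 (6 / 5 :: real)"
      "real i * log 2 (6 / 5) \<le> log 2 (real (num_nodes T))"
      by linarith+
    moreover from this(1) have "real i * 1 \<le> real i * (4 * log 2 (6 / 5))"
      by (intro mult_left_mono) auto
    ultimately show ?thesis by linarith
  qed
  have ex: "\<exists>k. \<not> ?n k > 1"
  proof (rule ccontr)
    assume "\<not> ?thesis"
    then have "real i \<le> 4 * log 2 (real (num_nodes T))" for i
      using small[of i] by (auto simp: not_le Suc_le_eq numeral_2_eq_2)
    then show False using reals_Archimedean2 not_le by blast
  qed
  define k where "k = (LEAST k. \<not> ?n k > 1)"
  have k: "\<not> ?n k > 1" "\<And>i. i < k \<Longrightarrow> ?n i > 1"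
    unfolding k_def using LeastI_ex[OF ex] not_less_Least by blast+
  have "while (\<lambda>es. num_edges es > 1) step (initial_edges T) = (step ^^ k) (initial_edges T)"
    unfolding while_def while_option_def k_def using ex by simp
  then have "top_tree T = edge_tree (hd ((step ^^ k) (initial_edges T)))"
    unfolding top_tree_def by (simp add: step_def[abs_def])
  moreover have "real k \<le> 1 + 4 * log 2 (real (num_nodes T))"
  proof (cases k)
    case 0
    have "num_nodes T \<ge> 1" using num_edges_initial_edges[of T] by simp
    then show ?thesis using 0 by simp
  next
    case (Suc i)
    then show ?thesis using small[of i] k(2) by (force simp: numeral_2_eq_2 Suc_le_eq)
  qed
  ultimately show thesis using that k(2) by blast
qed

section \<open>Upper bound for the size of the top DAG\<close>

lemma top_tree_in_top_trees:
  assumes "num_nodes T \<ge> 2" "top_tree T = edge_tree (hd ((step ^^ k) (initial_edges T)))"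
  shows "top_tree T \<in> top_trees ((step ^^ k) (initial_edges T))"
proof -
  let ?es = "(step ^^ k) (initial_edges T)"
  have "?es \<noteq> []"
  proof (induction k)
    case 0
    then show ?case using num_edges_initial_edges[of T] assms(1) by auto
  qed (simp add: step_eq_Nil_iff)
  then show ?thesis
    unfolding assms(2) in_top_trees[of _ ?es] by auto
qed

lemma graph_size_top_dag_le_card:
  assumes "num_nodes T \<ge> 2"
  shows "graph_size (top_dag T) \<le> 3 * card (subtrees (top_tree T))"
proof -
  obtain k where "top_tree T = edge_tree (hd ((step ^^ k) (initial_edges T)))"
    using top_tree_iterate by blast
  from top_tree_in_top_trees[OF assms this]
  have "subtrees (top_tree T) \<subseteq> all_top_subtrees ((step ^^ k) (initial_edges T))"
    by (auto simp: all_top_subtrees_def)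
  then show ?thesis
    unfolding top_dag_def using binary_iterate by (intro graph_size_binary) blast
qed

lemma graph_size_top_dag_le:
  assumes "num_nodes T \<ge> 2"
  shows "real (graph_size (top_dag T))
    \<le> 66 * log 2 (real (num_nodes T)) * real (graph_size (minimal_dag T))"
proof -
  obtain k where k: "top_tree T = edge_tree (hd ((step ^^ k) (initial_edges T)))"
    "real k \<le> 1 + 4 * log 2 (real (num_nodes T))"
    using top_tree_iterate by blast
  let ?es = "(step ^^ k) (initial_edges T)"
  let ?A = "card (arcs (minimal_dag T))" and ?L = "log 2 (real (num_nodes T))"
  have "subtrees (top_tree T) \<subseteq> all_top_subtrees ?es"
    using top_tree_in_top_trees[OF assms k(1)] by (auto simp: all_top_subtrees_def)
  then have "3 * card (subtrees (top_tree T)) \<le> 3 * card (all_top_subtrees ?es)"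
    by (intro mult_left_mono card_mono) auto
  also have "\<dots> \<le> 3 * ((2 * k + 1) * (2 * ?A))"
    by (intro mult_left_mono card_all_top_subtrees_iterate) auto
  finally have "graph_size (top_dag T) \<le> 3 * ((2 * k + 1) * (2 * ?A))"
    using graph_size_top_dag_le_card[OF assms] by linarith
  then have "real (graph_size (top_dag T)) \<le> real (3 * ((2 * k + 1) * (2 * ?A)))"
    by (simp only: of_nat_le_iff)
  also have "\<dots> = (12 * real k + 6) * real ?A" by (simp add: algebra_simps)
  also have "\<dots> \<le> (66 * ?L) * real (graph_size (minimal_dag T))"
  proof (intro mult_mono)
    \<comment> \<open>The bound on \<open>k\<close> gives \<open>12 * k + 6 <= 18 + 48 * ?L\<close>,
      and \<open>?L >= 1\<close> absorbs the 18 into the constant 66.\<close>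
    have "?L \<ge> 1" using assms by (simp add: le_log_iff)
    then show "12 * real k + 6 \<le> 66 * ?L" "0 \<le> 66 * ?L" using k(2) by linarith+
  qed (auto simp: graph_size_def)
  finally show ?thesis .
qed


section \<open>Unary paths\<close>

fun unary_path :: "'l \<Rightarrow> nat \<Rightarrow> 'l tree" where
  "unary_path a 0 = Node a []"
| "unary_path a (Suc n) = Node a [unary_path a n]"

lemma num_nodes_unary_path [simp]: "num_nodes (unary_path a n) = n + 1"
  by (induction n) auto

lemma subtrees_unary_path: "subtrees (unary_path a n) = unary_path a ` {..n}"
  by (induction n) (auto simp: atMost_Suc)

lemma graph_size_unary_path: "graph_size (minimal_dag (unary_path a n)) \<ge> n + 1"
proof -
  have "inj (unary_path a)"
    by (rule inj_on_inverseI[of _ "\<lambda>t. num_nodes t - 1"]) simp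
  then have "card (subtrees (unary_path a n)) = n + 1"
    by (simp add: subtrees_unary_path card_image inj_on_subset)
  then show ?thesis by (simp add: graph_size_def minimal_dag_def)
qed

lemma horizontal_step_attach_path:
  "horizontal_step es = es \<Longrightarrow> horizontal_step (attach_path cs es) = attach_path cs es"
  by (induction cs arbitrary: es) (auto simp: horizontal_step_def)

lemma attach_path_Nil:
  assumes "cs \<noteq> []"
  obtains e where "attach_path cs [] = [e]" "path_edges e = map (\<lambda>c. (c, False)) cs"
    "path_end e = []" "edge_cluster e = last cs"
  using assms
proof (induction cs arbitrary: thesis rule: rev_induct)
  case (snoc c cs)
  show ?case
  proof (cases "cs = []")
    case True
    then show ?thesis using snoc(2)[of "Edge c False []"] by simp
  next
    case False
    obtain e where "attach_path cs [] = [e]" "path_edges e = map (\<lambda>c. (c, False)) cs"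
      "path_end e = []"
      using snoc(1)[OF _ False] .
    then show ?thesis using snoc(2)[of "Edge c False [e]"] by (simp add: attach_path_append)
  qed
qed simp

lemma step_attach_path:
  assumes "cs \<noteq> []"
  shows "step (attach_path cs []) = attach_path (vertical_pairs (map (\<lambda>c. (c, False)) cs)) []"
proof -
  obtain e where "attach_path cs [] = [e]" "path_edges e = map (\<lambda>c. (c, False)) cs"
    "path_end e = []"
    using attach_path_Nil[OF assms] .
  then show ?thesis
    using horizontal_step_attach_path[of "[]" cs] by (simp add: step_def)
qed

lemma vertical_pairs_replicate:
  "vertical_pairs (map (\<lambda>c. (c, False)) (replicate (2 * m) c)) = replicate m (merge_vertical c c)"
  by (induction m) auto

text \<open>The bottom cluster \<open>b\<close> is kept apart: in the path it has no bottom boundary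
  node, so its merges are of type (b), those among the others of type (a).\<close>

lemma step_replicate:
  "step (attach_path (b # replicate (2 * m + 1) c) [])
    = attach_path (merge_vertical c b # replicate m (merge_vertical c c)) []"
proof -
  have "vertical_pairs (map (\<lambda>c. (c, False)) (b # replicate (2 * m + 1) c))
      = merge_vertical c b # replicate m (merge_vertical c c)"
    using vertical_pairs_replicate[of m c] by simp
  then show ?thesis by (metis step_attach_path list.distinct(1))
qed

lemma label_unary_path [simp]: "label (unary_path a n) = a"
  by (cases n) auto

lemma initial_edges_unary_path:
  "initial_edges (unary_path a (Suc n)) =
    attach_path (Cluster (Node (Edge_Label (a, a)) []) False #
      replicate n (Cluster (Node (Edge_Label (a, a)) []) True)) []"
proof (induction n)
  case (Suc n)
  have "attach_path (b # replicate (Suc n) c) [] = [Edge c False (attach_path (b # replicate n c) [])]"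
    for b c :: "'a cluster"
    by (simp add: attach_path_append flip: replicate_append_same)
  then show ?case using Suc by simp
qed simp

lemma subtrees_merge_vertical:
  "subtrees (cluster_top_tree (merge_vertical c d)) =
    insert (cluster_top_tree (merge_vertical c d))
      (subtrees (cluster_top_tree c) \<union> subtrees (cluster_top_tree d))"
  by (cases c; cases d) simp

text \<open>A power of two keeps the number of clusters even until one is left, so no leftover
  cluster creates a third kind. Each iteration adds at most two vertices, one for each kind.\<close>

lemma unary_path_iterate:
  assumes "i \<le> k"
  shows "\<exists>b c. (step ^^ i) (initial_edges (unary_path a (2 ^ k))) =
      attach_path (b # replicate (2 ^ (k - i) - 1) c) [] \<and>
    card (subtrees (cluster_top_tree b) \<union> subtrees (cluster_top_tree c)) \<le> 2 + 2 * i"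
  using assms
proof (induction i)
  case 0
  obtain n where "(2::nat) ^ k = Suc n" by (metis not0_implies_Suc power_not_zero zero_neq_numeral)
  then show ?case
    using initial_edges_unary_path[of a n]
    by (intro exI[of _ "Cluster (Node (Edge_Label (a, a)) []) False"]
      exI[of _ "Cluster (Node (Edge_Label (a, a)) []) True"]) simp
next
  case (Suc i)
  then obtain b c where bc: "(step ^^ i) (initial_edges (unary_path a (2 ^ k))) =
      attach_path (b # replicate (2 ^ (k - i) - 1) c) []"
    "card (subtrees (cluster_top_tree b) \<union> subtrees (cluster_top_tree c)) \<le> 2 + 2 * i"
    by auto
  let ?m = "2 ^ (k - Suc i) - 1 :: nat"
  have "k - i = Suc (k - Suc i)" using Suc.prems by simp
  then have "2 ^ (k - i) = 2 * (2 ^ (k - Suc i) :: nat)" by simp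
  moreover have "(2 ^ (k - Suc i) :: nat) \<ge> 1" by simp
  ultimately have "2 ^ (k - i) - 1 = 2 * ?m + (1 :: nat)" by linarith
  then have step: "(step ^^ Suc i) (initial_edges (unary_path a (2 ^ k))) =
      attach_path (merge_vertical c b # replicate ?m (merge_vertical c c)) []"
    using bc(1) step_replicate[of b ?m c] by simp
  let ?x = "cluster_top_tree (merge_vertical c b)" and ?y = "cluster_top_tree (merge_vertical c c)"
  let ?S = "subtrees (cluster_top_tree b) \<union> subtrees (cluster_top_tree c)"
  have "subtrees ?x \<union> subtrees ?y = insert ?x (insert ?y ?S)"
    by (auto simp: subtrees_merge_vertical)
  moreover have "card (insert ?x (insert ?y ?S)) \<le> Suc (Suc (card ?S))"
    by (simp add: card_insert_if finite_subtrees)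
  ultimately show ?case using step bc(2) by (intro exI conjI) auto
qed

lemma graph_size_top_dag_unary_path:
  "graph_size (top_dag (unary_path a (2 ^ k))) \<le> 6 + 6 * k"
proof -
  let ?T = "unary_path a (2 ^ k)"
  obtain i where i: "top_tree ?T = edge_tree (hd ((step ^^ i) (initial_edges ?T)))"
    "\<And>j. j < i \<Longrightarrow> num_edges ((step ^^ j) (initial_edges ?T)) > 1"
    using top_tree_iterate[of ?T] by blast
  obtain b c where "(step ^^ k) (initial_edges ?T) = attach_path (b # replicate (2 ^ (k - k) - 1) c) []"
    using unary_path_iterate[of k k a] by blast
  \<comment> \<open>After \<open>k\<close> iterations a single edge is left, so the loop has stopped
    by then.\<close>
  then have "i \<le> k" using i(2)[of k] by (cases "i \<le> k") auto
  then obtain b c where bc: "(step ^^ i) (initial_edges ?T) =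
      attach_path (b # replicate (2 ^ (k - i) - 1) c) []"
    "card (subtrees (cluster_top_tree b) \<union> subtrees (cluster_top_tree c)) \<le> 2 + 2 * i"
    using unary_path_iterate[of i k a] by blast
  let ?cs = "b # replicate (2 ^ (k - i) - 1) c"
  obtain e where "attach_path ?cs [] = [e]" "edge_cluster e = last ?cs"
    by (metis attach_path_Nil list.distinct(1))
  then have "top_tree ?T = cluster_top_tree (last ?cs)"
    by (simp only: i(1) bc(1) list.sel)
  moreover have "last ?cs \<in> {b, c}"
    using last_in_set[of ?cs] by (auto split: if_splits)
  ultimately have "subtrees (top_tree ?T)
      \<subseteq> subtrees (cluster_top_tree b) \<union> subtrees (cluster_top_tree c)"
    by auto
  then have "card (subtrees (top_tree ?T)) \<le> 2 + 2 * i"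
    using bc(2) card_mono finite_subtrees by (meson finite_UnI order_trans)
  moreover have "num_nodes ?T \<ge> 2" by simp
  ultimately show ?thesis
    using graph_size_top_dag_le_card[of ?T] \<open>i \<le> k\<close> by linarith
qed

theorem theorem2:
  shows "(\<exists>C > 0. \<forall>T :: 'l tree. num_nodes T \<ge> 2 \<longrightarrow>
            real (graph_size (top_dag T))
              \<le> C * log 2 (real (num_nodes T)) * real (graph_size (minimal_dag T)))
       \<and> (\<exists>c > 0. \<exists>\<F> :: 'l tree set.
            (\<forall>N. \<exists>T \<in> \<F>. num_nodes T \<ge> N) \<and>
            (\<forall>T \<in> \<F>. num_nodes T \<ge> 2 \<and>
              real (graph_size (minimal_dag T))
                \<ge> c * (real (num_nodes T) / log 2 (real (num_nodes T)))
                    * real (graph_size (top_dag T))))"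
proof
  show "\<exists>C > 0. \<forall>T :: 'l tree. num_nodes T \<ge> 2 \<longrightarrow>
      real (graph_size (top_dag T))
        \<le> C * log 2 (real (num_nodes T)) * real (graph_size (minimal_dag T))"
    by (intro exI[of _ 66]) (simp add: graph_size_top_dag_le)
  \<comment> \<open>The exponent \<open>Suc k\<close> is at least 1, so \<open>6 + 6 * Suc k\<close>
    is at most 12 times the logarithm; this is the constant 1 / 12.\<close>
  define path where "path k = unary_path (undefined :: 'l) (2 ^ Suc k)" for k
  have large: "\<exists>T \<in> range path. num_nodes T \<ge> N" for N
  proof
    have "num_nodes (path N) = 2 * 2 ^ N + 1" by (simp add: path_def)
    then show "num_nodes (path N) \<ge> N" using less_exp[of N] by linarith
  qed simp
  have "num_nodes T \<ge> 2 \<and> real (graph_size (minimal_dag T))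
      \<ge> 1 / 12 * (real (num_nodes T) / log 2 (real (num_nodes T))) * real (graph_size (top_dag T))"
    if "T \<in> range path" for T
  proof -
    obtain k where T: "T = unary_path undefined (2 ^ Suc k)"
      using \<open>T \<in> range path\<close> by (auto simp: path_def)
    let ?L = "log 2 (real (num_nodes T))"
    have "log 2 (2 ^ Suc k) \<le> ?L"
      by (subst log_le_cancel_iff) (auto simp: T intro: add_pos_pos)
    then have L: "real (Suc k) \<le> ?L" by (simp add: log_nat_power del: power_Suc)
    have "real (graph_size (top_dag T)) \<le> real (6 + 6 * Suc k)"
      unfolding T of_nat_le_iff by (rule graph_size_top_dag_unary_path)
    also have "\<dots> \<le> 12 * ?L" using L by simp
    finally have "1 / 12 * (real (num_nodes T) / ?L) * real (graph_size (top_dag T))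
        \<le> 1 / 12 * (real (num_nodes T) / ?L) * (12 * ?L)"
      using L by (intro mult_left_mono) auto
    also have "\<dots> = real (num_nodes T)" using L by simp
    also have "\<dots> \<le> real (graph_size (minimal_dag T))"
      unfolding T of_nat_le_iff num_nodes_unary_path by (rule graph_size_unary_path)
    finally show ?thesis by (simp add: T)
  qed
  then show "\<exists>c > 0. \<exists>\<F> :: 'l tree set.
      (\<forall>N. \<exists>T \<in> \<F>. num_nodes T \<ge> N) \<and>
      (\<forall>T \<in> \<F>. num_nodes T \<ge> 2 \<and>
        real (graph_size (minimal_dag T))
          \<ge> c * (real (num_nodes T) / log 2 (real (num_nodes T)))
              * real (graph_size (top_dag T)))"
    using large by (intro exI[of _ "1 / 12"] exI[of _ "range path"] conjI ballI) auto
qed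

end
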